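(* Let $1\le k\le m$ and let $\mathcal{U}=\{h\in[0,1]^m:\sum_{i=1}^mh_i\le k\}$ be the budget of uncertainty set. Put $\beta=\min\big(k,\frac mk\big)$. Then $\hat{\mathcal{U}}=\beta\cdot\mathrm{conv}\big(e_1,\dots,e_m,\frac km e\big)$ dominates $\mathcal{U}$. In particular, the piecewise affine solution described in the context (with this $\beta$ and $\gamma=\frac km$) gives a $2\beta$-approximation to $\Pi_{AR}(\mathcal{U})$.
   Context: Vector inequalities are componentwise; $e_i$ is the $i$-th standard basis vector and $e$ the all-ones vector of $\mathbb{R}^m$; $(a)^+=\max(a,0)$; $\mathrm{conv}$ denotes convex hull. Two-stage adjustable robust problem $\Pi_{AR}(\mathcal{S})$: the data are $A\in\mathbb{R}_+^{m\times n}$, $B\in\mathbb{R}^{m\times n}$, $c,d\in\mathbb{R}^n_+$. For a set $\mathcal{S}\subseteq\mathbb{R}^m_+$, a feasible solution is a pair $(x,y(\cdot))$ with $x\in\mathbb{R}^n_+$, $y:\mathcal{S}\to\mathbb{R}^n_+$ and $Ax+By(h)\ge h$ for all $h\in\mathcal{S}$; the optimal value $z_{AR}(\mathcal{S})$ is the minimum (infimum) over feasible solutions of the worst-case cost $c^Tx+\max_{h\in\mathcal{S}}d^Ty(h)$ (max read as supremum; value $+\infty$ if infeasible). An optimal solution is a feasible solution whose worst-case cost equals $z_{AR}(\mathcal{S})<\infty$. A solution $(x,y(\cdot))$ gives an $\alpha$-approximation for $\Pi_{AR}(\mathcal{U})$ if it is feasible for $\Pi_{AR}(\mathcal{U})$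 and $c^Tx+d^Ty(h)\le\alpha\cdot z_{AR}(\mathcal{U})$ for all $h\in\mathcal{U}$. Domination: $\hat{\mathcal{U}}\subseteq\mathbb{R}^m_+$ dominates $\mathcal{U}$ if for every $h\in\mathcal{U}$ there is $\hat h\in\hat{\mathcal{U}}$ with $\hat h\ge h$. Piecewise affine solution with parameters $\beta,\gamma$: let $(\hat x,\hat y(\cdot))$ be an optimal solution (assumed to exist) of $\Pi_{AR}$ over $\beta\cdot\mathrm{conv}(e_1,\dots,e_m,\gamma e)$. The piecewise affine solution is $x=2\hat x$, $y(h)=\frac1\beta\sum_{i=1}^m(h_i-\beta\gamma)^+\hat y(\beta e_i)+\hat y(\beta\gamma e)$ for $h\in\mathcal{U}$. *)

theory Defs
  imports "HOL-Analysis.Analysis"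
begin

text \<open>
  The order on \<^typ>\<open>real^'m\<close> is the componentwise one. The dimensions
  \<open>m\<close> and \<open>n\<close> are \<open>CARD('m)\<close> and \<open>CARD('n)\<close>. Policies \<open>y\<close> are total functions, but only
  their values on the uncertainty set \<open>S\<close> are ever constrained or charged.
\<close>

definition ones :: "real^'m" where
  "ones = (\<chi> i. 1)"

definition ar_feasible ::
  "real^'n^'m \<Rightarrow> real^'n^'m \<Rightarrow> (real^'m) set \<Rightarrow> real^'n \<Rightarrow> (real^'m \<Rightarrow> real^'n) \<Rightarrow> bool" where
  "ar_feasible A B S x y \<longleftrightarrow>
     0 \<le> x \<and> (\<forall>h\<in>S. 0 \<le> y h) \<and> (\<forall>h\<in>S. h \<le> A *v x + B *v y h)"

text \<open>
  Costs are extended reals, so an unbounded second-stage cost has value \<open>\<infinity>\<close>, and the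
  infimum over an empty feasible set is \<open>\<infinity>\<close>. The worst-case cost is only meaningful for
  nonempty \<open>S\<close>.
\<close>

definition ar_cost ::
  "real^'n \<Rightarrow> real^'n \<Rightarrow> (real^'m) set \<Rightarrow> real^'n \<Rightarrow> (real^'m \<Rightarrow> real^'n) \<Rightarrow> ereal" where
  "ar_cost c d S x y = ereal (c \<bullet> x) + (SUP h\<in>S. ereal (d \<bullet> y h))"

definition z_AR ::
  "real^'n^'m \<Rightarrow> real^'n^'m \<Rightarrow> real^'n \<Rightarrow> real^'n \<Rightarrow> (real^'m) set \<Rightarrow> ereal" where
  "z_AR A B c d S = Inf {ar_cost c d S x y | x y. ar_feasible A B S x y}"

definition ar_optimal ::
  "real^'n^'m \<Rightarrow> real^'n^'m \<Rightarrow> real^'n \<Rightarrow> real^'n \<Rightarrow> (real^'m) set \<Rightarrow>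
   real^'n \<Rightarrow> (real^'m \<Rightarrow> real^'n) \<Rightarrow> bool" where
  "ar_optimal A B c d S x y \<longleftrightarrow>
     ar_feasible A B S x y \<and> ar_cost c d S x y = z_AR A B c d S \<and> z_AR A B c d S < \<infinity>"

definition ar_approximation ::
  "real \<Rightarrow> real^'n^'m \<Rightarrow> real^'n^'m \<Rightarrow> real^'n \<Rightarrow> real^'n \<Rightarrow> (real^'m) set \<Rightarrow>
   real^'n \<Rightarrow> (real^'m \<Rightarrow> real^'n) \<Rightarrow> bool" where
  "ar_approximation \<alpha> A B c d U x y \<longleftrightarrow>
     ar_feasible A B U x y \<and>
     (\<forall>h\<in>U. ereal (c \<bullet> x + d \<bullet> y h) \<le> ereal \<alpha> * z_AR A B c d U)"

definition dominates :: "(real^'m) set \<Rightarrow> (real^'m) set \<Rightarrow> bool" where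
  "dominates V U \<longleftrightarrow> (\<forall>v\<in>V. 0 \<le> v) \<and> (\<forall>h\<in>U. \<exists>v\<in>V. h \<le> v)"

definition budget_set :: "real \<Rightarrow> (real^'m) set" where
  "budget_set k = {h. (\<forall>i. 0 \<le> h $ i \<and> h $ i \<le> 1) \<and> (\<Sum>i\<in>UNIV. h $ i) \<le> k}"

definition dominating_set :: "real \<Rightarrow> real \<Rightarrow> (real^'m) set" where
  "dominating_set \<beta> \<gamma> =
     (\<lambda>v. \<beta> *\<^sub>R v) ` (convex hull (range (\<lambda>i. axis i 1) \<union> {\<gamma> *\<^sub>R ones}))"

definition pw_affine_x :: "real^'n \<Rightarrow> real^'n" where
  "pw_affine_x xh = 2 *\<^sub>R xh"

definition pw_affine_y ::
  "real \<Rightarrow> real \<Rightarrow> (real^'m \<Rightarrow> real^'n) \<Rightarrow> real^'m \<Rightarrow> real^'n" where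
  "pw_affine_y \<beta> \<gamma> yh h =
     (1 / \<beta>) *\<^sub>R (\<Sum>i\<in>UNIV. max (h $ i - \<beta> * \<gamma>) 0 *\<^sub>R yh (\<beta> *\<^sub>R axis i 1))
     + yh ((\<beta> * \<gamma>) *\<^sub>R ones)"

end

(*
  For the cost bound, scaling a policy on conv(e_1, ..., e_m, gamma e), which lies inside the budget
  set, by beta costs a factor beta, so the optimal value over the dominating set is at most
  beta z_AR(U).  Writing w_i = (h_i - beta gamma)^+ / beta, the weights w_i sum to at most 1 on the
  budget set, so one copy of xh pays for the w-combination of the constraints at beta e_i and the
  other for the constraint at beta gamma e; together they cover h at twice the optimal cost.
*)

theory Submission
  imports Defs
begin

section \<open>Monotonicity of feasibility, cost and value in the uncertainty set\<close>

lemma ar_feasible_mono: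
  assumes "ar_feasible A B T x y" and "S \<subseteq> T"
  shows "ar_feasible A B S x y"
  using assms unfolding ar_feasible_def by blast

lemma ar_cost_mono:
  assumes "S \<subseteq> T"
  shows "ar_cost c d S x y \<le> ar_cost c d T x y"
  unfolding ar_cost_def by (intro add_left_mono SUP_subset_mono assms order_refl)

lemma z_AR_le_cost:
  assumes "ar_feasible A B S x y"
  shows "z_AR A B c d S \<le> ar_cost c d S x y"
  unfolding z_AR_def using assms by (intro Inf_lower) blast

lemma z_AR_greatest:
  assumes "\<And>x y. ar_feasible A B S x y \<Longrightarrow> z \<le> ar_cost c d S x y"
  shows "z \<le> z_AR A B c d S"
  unfolding z_AR_def using assms by (intro Inf_greatest) blast

lemma z_AR_mono:
  assumes "S \<subseteq> T"
  shows "z_AR A B c d S \<le> z_AR A B c d T"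
  using assms by (meson ar_cost_mono ar_feasible_mono order_trans z_AR_greatest z_AR_le_cost)

lemma point_cost_le_ar_cost:
  assumes "h \<in> S"
  shows "ereal (c \<bullet> x + d \<bullet> y h) \<le> ar_cost c d S x y"
proof -
  have "ereal (d \<bullet> y h) \<le> (SUP h\<in>S. ereal (d \<bullet> y h))"
    by (rule SUP_upper[OF assms])
  then show ?thesis
    unfolding ar_cost_def plus_ereal.simps(1)[symmetric] by (rule add_left_mono)
qed

section \<open>Positive homogeneity of the problem under scaling of the uncertainty set\<close>

lemma ar_feasible_scale:
  fixes A B :: "real^'n^'m"
  assumes "0 < b" and feas: "ar_feasible A B S x y"
  shows "ar_feasible A B ((\<lambda>v. b *\<^sub>R v) ` S) (b *\<^sub>R x) (\<lambda>v. b *\<^sub>R y ((1 / b) *\<^sub>R v))"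
proof -
  have "b *\<^sub>R v \<le> A *v (b *\<^sub>R x) + B *v (b *\<^sub>R y v)" if "v \<in> S" for v
  proof -
    have "b *\<^sub>R v \<le> b *\<^sub>R (A *v x + B *v y v)"
      using feas that \<open>0 < b\<close> unfolding ar_feasible_def
      by (auto simp: less_eq_vec_def)
    also have "\<dots> = A *v (b *\<^sub>R x) + B *v (b *\<^sub>R y v)"
      by (simp add: scaleR_add_right matrix_vector_mult_scaleR)
    finally show ?thesis .
  qed
  then show ?thesis
    using feas \<open>0 < b\<close> unfolding ar_feasible_def by (auto simp: less_eq_vec_def)
qed

lemma ar_cost_scale_le:
  assumes "0 < b"
  shows "ar_cost c d ((\<lambda>v. b *\<^sub>R v) ` S) (b *\<^sub>R x) (\<lambda>v. b *\<^sub>R y ((1 / b) *\<^sub>R v))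
    \<le> ereal b * ar_cost c d S x y"
proof -
  let ?Y = "SUP h\<in>S. ereal (d \<bullet> y h)"
  have "(SUP h\<in>(\<lambda>v. b *\<^sub>R v) ` S. ereal (d \<bullet> b *\<^sub>R y ((1 / b) *\<^sub>R h))) \<le> ereal b * ?Y"
  proof (intro SUP_least)
    fix h assume "h \<in> (\<lambda>v. b *\<^sub>R v) ` S"
    then obtain v where v: "v \<in> S" "h = b *\<^sub>R v" by blast
    have "ereal (d \<bullet> y v) \<le> ?Y"
      by (rule SUP_upper[OF v(1)])
    then have "ereal b * ereal (d \<bullet> y v) \<le> ereal b * ?Y"
      using assms by (intro ereal_mult_left_mono) auto
    then show "ereal (d \<bullet> b *\<^sub>R y ((1 / b) *\<^sub>R h)) \<le> ereal b * ?Y"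
      using assms v(2) by simp
  qed
  then have "ar_cost c d ((\<lambda>v. b *\<^sub>R v) ` S) (b *\<^sub>R x) (\<lambda>v. b *\<^sub>R y ((1 / b) *\<^sub>R v))
    \<le> ereal b * ereal (c \<bullet> x) + ereal b * ?Y"
    unfolding ar_cost_def by (simp add: add_left_mono)
  \<comment> \<open>The supremum may be infinite; distributivity over \<open>ereal\<close> still
    holds because \<open>b\<close> and the first-stage cost are finite.\<close>
  also have "\<dots> = ereal b * ar_cost c d S x y"
    unfolding ar_cost_def using assms by (intro ereal_distrib_left[symmetric]) auto
  finally show ?thesis .
qed

lemma z_AR_scale_le:
  assumes "0 < b"
  shows "z_AR A B c d ((\<lambda>v. b *\<^sub>R v) ` S) \<le> ereal b * z_AR A B c d S"
proof -
  let ?z = "z_AR A B c d ((\<lambda>v. b *\<^sub>R v) ` S)"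
  \<comment> \<open>The infimum on the right need not be attained, so the factor is moved to the
    left, where it becomes part of a lower bound for every feasible cost.\<close>
  have "?z / ereal b \<le> z_AR A B c d S"
  proof (rule z_AR_greatest)
    fix x y assume "ar_feasible A B S x y"
    then have "?z \<le> ereal b * ar_cost c d S x y"
      using assms by (meson ar_cost_scale_le ar_feasible_scale order_trans z_AR_le_cost)
    then show "?z / ereal b \<le> ar_cost c d S x y"
      using assms by (simp add: ereal_divide_le_pos)
  qed
  then show ?thesis
    using assms by (simp add: ereal_divide_le_pos)
qed

section \<open>Geometry of the budget set and of the dominating set\<close>

lemma convex_budget_set: "convex (budget_set k :: (real^'m) set)"
proof (rule convexI)
  fix x y :: "real^'m" and u v :: real
  assume x: "x \<in> budget_set k" and y: "y \<in> budget_set k"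
    and uv: "0 \<le> u" "0 \<le> v" "u + v = 1"
  have "(\<Sum>i\<in>UNIV. (u *\<^sub>R x + v *\<^sub>R y) $ i) = u * (\<Sum>i\<in>UNIV. x $ i) + v * (\<Sum>i\<in>UNIV. y $ i)"
    by (simp add: sum.distrib sum_distrib_left)
  also have "\<dots> \<le> k"
    using x y uv unfolding budget_set_def by (intro convex_bound_le) auto
  finally show "u *\<^sub>R x + v *\<^sub>R y \<in> budget_set k"
    using x y uv unfolding budget_set_def by (auto intro!: convex_bound_le)
qed

text \<open>By convexity the generators suffice: \<open>1 \<le> k\<close> admits the unit vectors,
  and \<open>k \<le> real CARD('m)\<close> keeps the entries of the last generator, which sum to
  \<open>k\<close>, at most 1. The inclusion serves twice: for nonnegativity of the dominating set
  and for comparing optimal values.\<close>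

lemma hull_subset_budget_set:
  fixes k :: real
  assumes "1 \<le> k" and "k \<le> real CARD('m)"
  shows "convex hull (range (\<lambda>i. axis i 1) \<union> {(k / real CARD('m)) *\<^sub>R ones})
    \<subseteq> (budget_set k :: (real^'m) set)"
proof (rule hull_minimal)
  show "range (\<lambda>i. axis i 1) \<union> {(k / real CARD('m)) *\<^sub>R ones} \<subseteq> (budget_set k :: (real^'m) set)"
    using assms by (auto simp: budget_set_def ones_def axis_def)
qed (rule convex_budget_set)

lemma scaled_axis_in_dominating_set: "\<beta> *\<^sub>R axis i 1 \<in> dominating_set \<beta> \<gamma>"
  unfolding dominating_set_def by (intro imageI hull_inc) auto

lemma scaled_ones_in_dominating_set: "(\<beta> * \<gamma>) *\<^sub>R ones \<in> dominating_set \<beta> \<gamma>"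
proof -
  have "\<beta> *\<^sub>R (\<gamma> *\<^sub>R ones) \<in> dominating_set \<beta> \<gamma>"
    unfolding dominating_set_def by (intro imageI hull_inc) auto
  then show ?thesis by simp
qed

lemma dominating_set_combination:
  fixes w :: "'m::finite \<Rightarrow> real"
  assumes "\<And>i. 0 \<le> w i" and "sum w UNIV \<le> 1"
  shows "\<beta> *\<^sub>R ((\<Sum>i\<in>UNIV. w i *\<^sub>R axis i 1) + (1 - sum w UNIV) *\<^sub>R (\<gamma> *\<^sub>R ones))
    \<in> dominating_set \<beta> \<gamma>"
proof -
  let ?C = "convex hull (range (\<lambda>i::'m. axis i 1) \<union> {\<gamma> *\<^sub>R ones}) :: (real^'m) set"
  \<comment> \<open>The generators are indexed by \<open>'m option\<close>, with \<open>None\<close>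
    standing for the multiple of the all-ones vector; it receives the leftover weight.\<close>
  let ?a = "\<lambda>j. case j of None \<Rightarrow> 1 - sum w UNIV | Some i \<Rightarrow> w i"
  let ?p = "\<lambda>j. case j of None \<Rightarrow> \<gamma> *\<^sub>R ones | Some i \<Rightarrow> (axis i 1 :: real^'m)"
  have "(\<Sum>j\<in>UNIV. ?a j *\<^sub>R ?p j) \<in> ?C"
  proof (rule convex_sum)
    show "sum ?a UNIV = 1"
      by (simp add: UNIV_option_conv sum.reindex)
    show "0 \<le> ?a j" for j
      using assms by (cases j) auto
    show "?p j \<in> ?C" for j
      by (cases j) (auto intro: hull_inc)
  qed auto
  moreover have "(\<Sum>j\<in>UNIV. ?a j *\<^sub>R ?p j)
    = (\<Sum>i\<in>UNIV. w i *\<^sub>R axis i 1) + (1 - sum w UNIV) *\<^sub>R (\<gamma> *\<^sub>R ones)"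
    by (simp add: UNIV_option_conv sum.reindex)
  ultimately show ?thesis
    unfolding dominating_set_def by (simp add: imageI)
qed

section \<open>Threshold weights, domination, and the piecewise affine policy\<close>

lemma sum_scaleR_axis: "(\<Sum>i\<in>UNIV. f i *\<^sub>R axis i (1::real)) $ j = f j"
  by (simp add: axis_def if_distrib[of "(*) _"] cong: if_cong)

text \<open>The two terms of the minimum act differently. If \<beta> is \<open>k\<close>, each
  excess over the nonnegative threshold is at most the entry itself, and the budget bounds the sum.
  If \<beta> is \<open>m/k\<close>, the threshold \<beta>\<gamma> equals 1 and every excess
  vanishes.\<close>

lemma pw_affine_weights_le:
  fixes h :: "real^'m"
  assumes "0 < k"
    and "\<beta> = min k (real CARD('m) / k)" and "\<gamma> = k / real CARD('m)"
    and h: "h \<in> budget_set k"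
  shows "(\<Sum>i\<in>UNIV. max (h $ i - \<beta> * \<gamma>) 0) \<le> \<beta>"
proof (cases "k \<le> real CARD('m) / k")
  case True
  have "(\<Sum>i\<in>UNIV. max (h $ i - \<beta> * \<gamma>) 0) \<le> (\<Sum>i\<in>UNIV. h $ i)"
    using assms by (intro sum_mono) (auto simp: budget_set_def)
  then show ?thesis
    using True h assms(2) by (auto simp: budget_set_def)
next
  case False
  then have "\<beta> * \<gamma> = 1" "0 \<le> \<beta>"
    using assms by (auto simp: min_def)
  moreover have "h $ i \<le> 1" for i
    using h by (simp add: budget_set_def)
  ultimately show ?thesis
    by (simp add: max_def sum_nonneg)
qed

text \<open>Again the minimum decides. For \<beta> = \<open>k\<close> a combination of the scaled
  unit vectors reproduces \<open>h\<close>, and the leftover weight only raises coordinates.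
  Otherwise \<beta>\<gamma> = 1, so the single point \<open>ones\<close> lies above the whole unit
  cube.\<close>

lemma dominates_budget_set:
  fixes k \<beta> \<gamma> :: real
  assumes k: "1 \<le> k" "k \<le> real CARD('m)"
    and \<beta>: "\<beta> = min k (real CARD('m) / k)"
    and \<gamma>: "\<gamma> = k / real CARD('m)"
  shows "dominates (dominating_set \<beta> \<gamma>) (budget_set k :: (real^'m) set)"
  unfolding dominates_def
proof (intro conjI ballI)
  have \<beta>0: "0 < \<beta>"
    using assms by auto
  fix v :: "real^'m" assume "v \<in> dominating_set \<beta> \<gamma>"
  then obtain u where u: "u \<in> budget_set k" "v = \<beta> *\<^sub>R u"
    using hull_subset_budget_set[OF k] unfolding dominating_set_def \<gamma> by blast
  then show "0 \<le> v"
    using \<beta>0 by (auto simp: budget_set_def less_eq_vec_def)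
next
  have \<beta>0: "0 < \<beta>" and \<gamma>0: "0 < \<gamma>"
    using assms by auto
  fix h :: "real^'m" assume h: "h \<in> budget_set k"
  show "\<exists>v\<in>dominating_set \<beta> \<gamma>. h \<le> v"
  proof (cases "k \<le> real CARD('m) / k")
    case True
    then have \<beta>k: "\<beta> = k" using \<beta> by simp
    \<comment> \<open>Division by \<beta> = \<open>k\<close> turns the budget constraint into a
      total weight of at most 1.\<close>
    let ?w = "\<lambda>i. h $ i / \<beta>"
    have w: "\<And>i. 0 \<le> ?w i" "sum ?w UNIV \<le> 1"
      using h \<beta>0 \<beta>k by (auto simp: budget_set_def sum_divide_distrib[symmetric])
    let ?v = "\<beta> *\<^sub>R ((\<Sum>i\<in>UNIV. ?w i *\<^sub>R axis i 1) + (1 - sum ?w UNIV) *\<^sub>R (\<gamma> *\<^sub>R ones))"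
    have "h $ j \<le> ?v $ j" for j
    proof -
      have "?v $ j = \<beta> * (?w j + (1 - sum ?w UNIV) * \<gamma>)"
        using sum_scaleR_axis[of ?w j] by (simp add: ones_def)
      also have "\<dots> = h $ j + \<beta> * ((1 - sum ?w UNIV) * \<gamma>)"
        using \<beta>0 by (simp add: distrib_left)
      finally show ?thesis
        using \<beta>0 \<gamma>0 w(2) by simp
    qed
    then have "h \<le> ?v" by (simp add: less_eq_vec_def)
    then show ?thesis
      using dominating_set_combination[of ?w, OF w] by blast
  next
    case False
    then have "\<beta> * \<gamma> = 1"
      using assms by (auto simp: min_def)
    then have "h \<le> (\<beta> * \<gamma>) *\<^sub>R ones"
      using h by (auto simp: budget_set_def less_eq_vec_def ones_def)
    then show ?thesis
      using scaled_ones_in_dominating_set by blast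
  qed
qed

text \<open>Each entry of \<open>h\<close> is at most its excess over \<beta>\<gamma> plus
  \<beta>\<gamma>. The two summands are covered separately, each with one copy of
  \<open>xh\<close>.\<close>

lemma pw_affine_feasible:
  fixes A B :: "real^'n^'m"
  assumes A: "\<And>i j. 0 \<le> A $ i $ j" and \<beta>: "0 < \<beta>"
    and feas: "ar_feasible A B (dominating_set \<beta> \<gamma>) xh yh"
    and weights: "\<And>h. h \<in> U \<Longrightarrow> (\<Sum>i\<in>UNIV. max (h $ i - \<beta> * \<gamma>) 0) \<le> \<beta>"
  shows "ar_feasible A B U (pw_affine_x xh) (pw_affine_y \<beta> \<gamma> yh)"
proof -
  let ?E = "\<lambda>i. \<beta> *\<^sub>R axis i 1 :: real^'m"
  let ?G = "(\<beta> * \<gamma>) *\<^sub>R ones :: real^'m"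
  have xh: "0 \<le> xh" and y_E: "\<And>i. 0 \<le> yh (?E i)" and y_G: "0 \<le> yh ?G"
    and cover_E: "\<And>i. ?E i \<le> A *v xh + B *v yh (?E i)"
    and cover_G: "?G \<le> A *v xh + B *v yh ?G"
    using feas scaled_axis_in_dominating_set scaled_ones_in_dominating_set
    unfolding ar_feasible_def by blast+
  \<comment> \<open>The sign condition on \<open>A\<close> enters here; it later allows the factor
    \<open>sum w UNIV\<close> in front of \<open>A *v xh\<close> to be replaced by 1.\<close>
  have Ax: "0 \<le> (A *v xh) $ j" for j
    using A xh by (auto simp: matrix_vector_mult_def less_eq_vec_def intro!: sum_nonneg)
  have "0 \<le> pw_affine_y \<beta> \<gamma> yh h" for h
    using y_E y_G \<beta> unfolding pw_affine_y_def
    by (auto simp: less_eq_vec_def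
        intro!: add_nonneg_nonneg divide_nonneg_pos mult_nonneg_nonneg sum_nonneg)
  moreover have "h $ j \<le> (A *v pw_affine_x xh + B *v pw_affine_y \<beta> \<gamma> yh h) $ j"
    if "h \<in> U" for h j
  proof -
    define w where "w i = max (h $ i - \<beta> * \<gamma>) 0 / \<beta>" for i
    have w0: "0 \<le> w i" for i
      using \<beta> by (simp add: w_def)
    have w1: "sum w UNIV \<le> 1"
      using weights[OF that] \<beta> by (simp add: w_def sum_divide_distrib[symmetric])
    have y: "pw_affine_y \<beta> \<gamma> yh h = (\<Sum>i\<in>UNIV. w i *\<^sub>R yh (?E i)) + yh ?G"
      by (simp add: pw_affine_y_def w_def scaleR_sum_right)
    have "B *v pw_affine_y \<beta> \<gamma> yh h = (\<Sum>i\<in>UNIV. w i *\<^sub>R (B *v yh (?E i))) + B *v yh ?G"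
      unfolding y
      by (simp add: matrix_vector_right_distrib matrix_vector_mult_scaleR
          linear_sum[OF matrix_vector_mul_linear])
    then have By: "(B *v pw_affine_y \<beta> \<gamma> yh h) $ j
      = (\<Sum>i\<in>UNIV. w i * (B *v yh (?E i)) $ j) + (B *v yh ?G) $ j"
      by simp
    \<comment> \<open>The factor 1/\<beta> in \<open>w\<close> cancels the length of the scaled unit
      vectors, so the combination has exactly the excess as its \<open>j\<close>-th entry.\<close>
    have "max (h $ j - \<beta> * \<gamma>) 0 = (\<Sum>i\<in>UNIV. w i * ?E i $ j)"
      using sum_scaleR_axis[of "\<lambda>i. w i * \<beta>" j] \<beta> by (simp add: w_def)
    also have "\<dots> \<le> (\<Sum>i\<in>UNIV. w i * ((A *v xh) $ j + (B *v yh (?E i)) $ j))"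
      using cover_E w0 by (intro sum_mono mult_left_mono) (auto simp: less_eq_vec_def)
    also have "\<dots> = sum w UNIV * (A *v xh) $ j + (\<Sum>i\<in>UNIV. w i * (B *v yh (?E i)) $ j)"
      by (simp add: distrib_left sum.distrib sum_distrib_right)
    also have "\<dots> \<le> (A *v xh) $ j + (\<Sum>i\<in>UNIV. w i * (B *v yh (?E i)) $ j)"
      using mult_right_mono[OF w1 Ax] by simp
    finally have "max (h $ j - \<beta> * \<gamma>) 0
      \<le> (A *v xh) $ j + (\<Sum>i\<in>UNIV. w i * (B *v yh (?E i)) $ j)" .
    moreover have "\<beta> * \<gamma> \<le> (A *v xh) $ j + (B *v yh ?G) $ j"
      using cover_G by (simp add: less_eq_vec_def ones_def)
    moreover have "(A *v pw_affine_x xh) $ j = 2 * (A *v xh) $ j"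
      by (simp add: pw_affine_x_def matrix_vector_mult_scaleR)
    ultimately show ?thesis
      using By by simp
  qed
  ultimately show ?thesis
    using xh unfolding ar_feasible_def by (auto simp: less_eq_vec_def pw_affine_x_def)
qed

text \<open>With \<open>z\<close> the worst-case cost, every second-stage cost on the dominating set
  is at most \<open>z - c \<bullet> xh\<close>. The weighted part and the threshold part of the
  policy each cost at most this, and the doubled first stage restores \<open>2 * z\<close>.\<close>

lemma pw_affine_cost_le:
  fixes c d :: "real^'n" and h :: "real^'m"
  assumes d: "0 \<le> d" and \<beta>: "0 < \<beta>"
    and feas: "ar_feasible A B (dominating_set \<beta> \<gamma>) xh yh"
    and weights: "(\<Sum>i\<in>UNIV. max (h $ i - \<beta> * \<gamma>) 0) \<le> \<beta>"
  shows "ereal (c \<bullet> pw_affine_x xh + d \<bullet> pw_affine_y \<beta> \<gamma> yh h)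
    \<le> 2 * ar_cost c d (dominating_set \<beta> \<gamma>) xh yh"
proof -
  let ?D = "dominating_set \<beta> \<gamma> :: (real^'m) set"
  let ?E = "\<lambda>i. \<beta> *\<^sub>R axis i 1 :: real^'m"
  let ?G = "(\<beta> * \<gamma>) *\<^sub>R ones :: real^'m"
  have point: "ereal (c \<bullet> xh + d \<bullet> yh v) \<le> ar_cost c d ?D xh yh" if "v \<in> ?D" for v
    by (rule point_cost_le_ar_cost[OF that])
  note G = scaled_ones_in_dominating_set[of \<beta> \<gamma>, where 'a = 'm]
  have yG: "0 \<le> d \<bullet> yh ?G"
    using feas G d unfolding ar_feasible_def
    by (auto simp: inner_vec_def less_eq_vec_def intro!: sum_nonneg mult_nonneg_nonneg)
  show ?thesis
  \<comment> \<open>Only a finite cost needs an argument: an infinite one makes the bound trivial,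
    and \<open>point\<close> at \<open>?G\<close> excludes minus infinity.\<close>
  proof (cases "ar_cost c d ?D xh yh")
    case (real z)
    have E_le: "d \<bullet> yh (?E i) \<le> z - c \<bullet> xh" for i
      using point[OF scaled_axis_in_dominating_set[of \<beta> i]] real by simp
    have G_le: "d \<bullet> yh ?G \<le> z - c \<bullet> xh"
      using point[OF G] real by simp
    define w where "w i = max (h $ i - \<beta> * \<gamma>) 0 / \<beta>" for i
    have w0: "0 \<le> w i" for i
      using \<beta> by (simp add: w_def)
    have w1: "sum w UNIV \<le> 1"
      using weights \<beta> by (simp add: w_def sum_divide_distrib[symmetric])
    have y: "pw_affine_y \<beta> \<gamma> yh h = (\<Sum>i\<in>UNIV. w i *\<^sub>R yh (?E i)) + yh ?G"
      by (simp add: pw_affine_y_def w_def scaleR_sum_right)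
    have "(\<Sum>i\<in>UNIV. w i * (d \<bullet> yh (?E i))) \<le> (\<Sum>i\<in>UNIV. w i * (z - c \<bullet> xh))"
      using E_le w0 by (intro sum_mono mult_left_mono)
    also have "\<dots> = sum w UNIV * (z - c \<bullet> xh)"
      by (simp add: sum_distrib_right)
    \<comment> \<open>\<open>yG\<close> and \<open>G_le\<close> make
      \<open>z - c \<bullet> xh\<close> nonnegative, so the weight sum can be bounded by 1.\<close>
    also have "\<dots> \<le> z - c \<bullet> xh"
      using mult_right_mono[OF w1, of "z - c \<bullet> xh"] yG G_le by simp
    finally have "c \<bullet> pw_affine_x xh + d \<bullet> pw_affine_y \<beta> \<gamma> yh h \<le> 2 * z"
      using G_le by (simp add: y pw_affine_x_def inner_add_right inner_sum_right)
    then show ?thesis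
      using real by simp
  next
    case MInf
    then show ?thesis using point[OF G] by simp
  qed simp
qed

theorem mainTheorem8:
  fixes k \<beta> \<gamma> :: real
  assumes "1 \<le> k" and "k \<le> real CARD('m)"
    and "\<beta> = min k (real CARD('m) / k)"
    and "\<gamma> = k / real CARD('m)"
  shows "dominates (dominating_set \<beta> \<gamma>) (budget_set k :: (real^'m) set) \<and>
    (\<forall>(A :: real^'n^'m) (B :: real^'n^'m) (c :: real^'n) (d :: real^'n) xh yh.
       (\<forall>i j. 0 \<le> A $ i $ j) \<longrightarrow> 0 \<le> c \<longrightarrow> 0 \<le> d \<longrightarrow>
       ar_optimal A B c d (dominating_set \<beta> \<gamma>) xh yh \<longrightarrow>
       ar_approximation (2 * \<beta>) A B c d (budget_set k)
         (pw_affine_x xh) (pw_affine_y \<beta> \<gamma> yh))"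
proof (intro conjI allI impI)
  show "dominates (dominating_set \<beta> \<gamma>) (budget_set k :: (real^'m) set)"
    by (rule dominates_budget_set[OF assms])
next
  fix A B :: "real^'n^'m" and c d :: "real^'n" and xh yh
  assume A: "\<forall>i j. 0 \<le> A $ i $ j" and d: "0 \<le> d"
    and opt: "ar_optimal A B c d (dominating_set \<beta> \<gamma>) xh yh"
  let ?U = "budget_set k :: (real^'m) set"
  let ?D = "dominating_set \<beta> \<gamma> :: (real^'m) set"
  have \<beta>0: "0 < \<beta>"
    using assms by auto
  have feas: "ar_feasible A B ?D xh yh"
    and cost: "ar_cost c d ?D xh yh = z_AR A B c d ?D"
    using opt unfolding ar_optimal_def by blast+
  have weights: "(\<Sum>i\<in>UNIV. max (h $ i - \<beta> * \<gamma>) 0) \<le> \<beta>" if "h \<in> ?U" for h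
    using pw_affine_weights_le[OF _ assms(3,4) that] assms(1) by simp
  have "z_AR A B c d ?D
    \<le> ereal \<beta> * z_AR A B c d (convex hull (range (\<lambda>i. axis i 1) \<union> {\<gamma> *\<^sub>R ones}))"
    unfolding dominating_set_def by (rule z_AR_scale_le[OF \<beta>0])
  \<comment> \<open>The unscaled hull lies inside the budget set, so the adversary is weaker on
    it.\<close>
  also have "\<dots> \<le> ereal \<beta> * z_AR A B c d ?U"
    using \<beta>0 hull_subset_budget_set[OF assms(1,2)] unfolding assms(4)
    by (intro ereal_mult_left_mono z_AR_mono) auto
  finally have "2 * z_AR A B c d ?D \<le> 2 * (ereal \<beta> * z_AR A B c d ?U)"
    by (intro ereal_mult_left_mono) auto
  also have "\<dots> = ereal (2 * \<beta>) * z_AR A B c d ?U"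
    by (simp flip: times_ereal.simps(1) add: mult.assoc)
  finally have z: "2 * z_AR A B c d ?D \<le> ereal (2 * \<beta>) * z_AR A B c d ?U" .
  show "ar_approximation (2 * \<beta>) A B c d ?U (pw_affine_x xh) (pw_affine_y \<beta> \<gamma> yh)"
    unfolding ar_approximation_def
  proof (intro conjI ballI)
    show "ar_feasible A B ?U (pw_affine_x xh) (pw_affine_y \<beta> \<gamma> yh)"
      using A \<beta>0 feas weights by (intro pw_affine_feasible) auto
  next
    fix h assume "h \<in> ?U"
    from pw_affine_cost_le[OF d \<beta>0 feas weights[OF this], of c] z
    show "ereal (c \<bullet> pw_affine_x xh + d \<bullet> pw_affine_y \<beta> \<gamma> yh h)
      \<le> ereal (2 * \<beta>) * z_AR A B c d ?U"
      unfolding cost by (rule order_trans)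
  qed
qed

end
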